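(* Let $(M,g)$ be a connected $7$-dimensional Riemannian manifold admitting a $G_2$-structure $\varphi$ (a definite $3$-form with associated metric $g$), and let $C_\varphi$ be the associated octonion algebra over $C^\infty(M)$ with bilinear form $b_g$. Let $A\in C_\varphi$, $A=A_r+A_i$ with $A_r\in C^\infty(M)$ and $A_i\in\Gamma(TM)$, satisfy $b_g(A,A)=2$. Then the algebraic twist and the geometric twist of $\varphi$ by $A$ coincide: $$\varphi_A=\tilde\varphi^A .$$ That is, for all $\alpha,\beta,\gamma\in\Gamma(TM)$, $$\tfrac12 b_g\big((\alpha A)(A^{-1}\beta),\gamma\big)=\Big((A_r^2-|A_i|^2)\varphi-2A_r\,A_i\lrcorner( *\varphi)+2A_i^\flat\wedge(A_i\lrcorner\varphi)\Big)(\alpha,\beta,\gamma),$$ where products on the left are taken in $C_\varphi$.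
   Context: On $\mathbb R^7$ with standard basis $e_1,\dots,e_7$ and dual basis $e^i$, put $\varphi_0=e^{123}+e^{145}+e^{167}+e^{246}-e^{257}-e^{347}-e^{356}$ (with $e^{ijk}=e^i\wedge e^j\wedge e^k$). A definite $3$-form on $M$ is a smooth $3$-form $\varphi$ such that at each $p$ there is a linear isomorphism $u:\mathbb R^7\to T_pM$ with $u^*\varphi_p=\varphi_0$; its associated metric and orientation are those for which all such $u$ are orientation-preserving isometries (with $e_1,\dots,e_7$ an oriented orthonormal basis of $\mathbb R^7$). $*$ is the Hodge star for this metric and orientation, so that in an adapted frame $*\varphi$ corresponds to $e^{4567}+e^{2367}+e^{2345}+e^{1357}-e^{1346}-e^{1256}-e^{1247}$. Definite $3$-forms are identified with $G_2$-structures. $C_\varphi=C^\infty(M)\oplus\Gamma(TM)$ with product $(a+\alpha)(b+\beta)=ab-g(\alpha,\beta)+a\beta+b\alpha+\alpha\times_\varphi\beta$, where $g(\alpha\times_\varphi\beta,\gamma)=\varphi(\alpha,\beta,\gamma)$ for all $\gamma$, identity $1$, and bilinear form $b_g(a+\alpha,d+\delta)=2ad+2g(\alpha,\delta)$. An $A\in C_\varphi$ with $b_g(A,A)=2$, i.e. $A_r^2+g(A_i,A_i)=1$, is invertible with $A^{-1}=A_r-A_i$. Algebraic twist: $\varphi_A(\alpha,\beta,\gamma):=\varphi(\alpha A,A^{-1}\beta,\gamma)$ for vector fields $\alpha,\beta,\gamma$, where $\varphi(x,y,\gamma)$ for $x,y\in C_\varphi$ means $\frac12 b_g(xy,\gamma)$.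 Geometric twist: $\tilde\varphi^A:=(A_r^2-|A_i|^2)\varphi-2A_r\,A_i\lrcorner( *\varphi)+2A_i^\flat\wedge(A_i\lrcorner\varphi)$, where $|A_i|^2=g(A_i,A_i)$, $A_i^\flat=g(A_i,-)$, and $A_i\lrcorner\sigma=\sigma(A_i,-,\dots,-)$. The wedge of a $1$-form $\omega$ and a $2$-form $\eta$ is $(\omega\wedge\eta)(\alpha_1,\alpha_2,\alpha_3)=\frac{1}{1!2!}\sum_{\sigma\in\mathfrak S_3}\mathrm{sgn}(\sigma)\,\omega(\alpha_{\sigma(1)})\eta(\alpha_{\sigma(2)},\alpha_{\sigma(3)})$. *)

theory Defs
  imports "HOL-Analysis.Analysis" "HOL-Library.Function_Algebras"
begin

section \<open>Functions as a real vector space\<close>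

text \<open>Tangent vectors are linear functionals, so the pointwise vector space structure on
  functions is needed.\<close>

instantiation "fun" :: (type, real_vector) real_vector
begin

definition scaleR_fun :: "real \<Rightarrow> ('a \<Rightarrow> 'b) \<Rightarrow> 'a \<Rightarrow> 'b"
  where "scaleR_fun c f = (\<lambda>x. c *\<^sub>R f x)"

instance
  by standard (auto simp: scaleR_fun_def plus_fun_def scaleR_add_right scaleR_add_left)

end

section \<open>Smooth manifolds\<close>

text \<open>\<open>Ck_on k S f\<close> is meant for open \<open>S\<close> in a finite-dimensional space: \<open>f\<close> is
  \<open>k\<close> times continuously differentiable on \<open>S\<close>.\<close>

primrec Ck_on :: "nat \<Rightarrow> 'e::euclidean_space set \<Rightarrow> ('e \<Rightarrow> 'f::real_normed_vector) \<Rightarrow> bool" where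
  "Ck_on 0 S f \<longleftrightarrow> continuous_on S f"
| "Ck_on (Suc k) S f \<longleftrightarrow>
     (\<forall>x\<in>S. f differentiable (at x)) \<and> (\<forall>v. Ck_on k S (\<lambda>x. frechet_derivative f (at x) v))"

definition smooth_on :: "'e::euclidean_space set \<Rightarrow> ('e \<Rightarrow> 'f::real_normed_vector) \<Rightarrow> bool" where
  "smooth_on S f \<longleftrightarrow> (\<forall>k. Ck_on k S f)"

text \<open>A manifold is a whole type \<open>'a\<close> (Hausdorff and second countable by its type class) with
  a smooth, not necessarily maximal, atlas.  Only the values of a chart on its domain, the first
  component, are relevant.\<close>

type_synonym ('a, 'e) chart = "'a set \<times> ('a \<Rightarrow> 'e)"

definition is_chart :: "('a::topological_space, 'e::euclidean_space) chart \<Rightarrow> bool" where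
  "is_chart = (\<lambda>(U, \<psi>). open U \<and> open (\<psi> ` U) \<and> (\<exists>\<psi>'. homeomorphism U (\<psi> ` U) \<psi> \<psi>'))"

definition smooth_atlas ::
    "('a::{t2_space, second_countable_topology}, 'e::euclidean_space) chart set \<Rightarrow> bool" where
  "smooth_atlas \<A> \<longleftrightarrow>
     (\<forall>c\<in>\<A>. is_chart c) \<and>
     (\<Union>(fst ` \<A>) = UNIV) \<and>
     (\<forall>(U, \<psi>)\<in>\<A>. \<forall>(V, \<theta>)\<in>\<A>. smooth_on (\<psi> ` (U \<inter> V)) (\<theta> \<circ> inv_into U \<psi>))"

definition smooth_functions :: "('a, 'e::euclidean_space) chart set \<Rightarrow> ('a \<Rightarrow> real) set" where
  "smooth_functions \<A> = {f. \<forall>(U, \<psi>)\<in>\<A>. smooth_on (\<psi> ` U) (f \<circ> inv_into U \<psi>)}"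

text \<open>The tangent space at \<open>p\<close> consists of the derivations at \<open>p\<close> of the algebra of smooth
  functions.  A derivation is set to \<open>0\<close> on functions that are not smooth, so that it is
  determined by its action on smooth functions.\<close>

type_synonym 'a tvec = "('a \<Rightarrow> real) \<Rightarrow> real"

definition tangent_space :: "('a, 'e::euclidean_space) chart set \<Rightarrow> 'a \<Rightarrow> 'a tvec set" where
  "tangent_space \<A> p = {D.
     (\<forall>f. f \<notin> smooth_functions \<A> \<longrightarrow> D f = 0) \<and>
     (\<forall>f\<in>smooth_functions \<A>. \<forall>h\<in>smooth_functions \<A>. D (\<lambda>q. f q + h q) = D f + D h) \<and>
     (\<forall>c. \<forall>f\<in>smooth_functions \<A>. D (\<lambda>q. c * f q) = c * D f) \<and>
     (\<forall>f\<in>smooth_functions \<A>. \<forall>h\<in>smooth_functions \<A>.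
        D (\<lambda>q. f q * h q) = D f * h p + f p * D h)}"

definition vector_fields :: "('a, 'e::euclidean_space) chart set \<Rightarrow> ('a \<Rightarrow> 'a tvec) set" where
  "vector_fields \<A> = {X. (\<forall>p. X p \<in> tangent_space \<A> p) \<and>
     (\<forall>f\<in>smooth_functions \<A>. (\<lambda>p. X p f) \<in> smooth_functions \<A>)}"

definition linear_form_on :: "'v::real_vector set \<Rightarrow> ('v \<Rightarrow> real) \<Rightarrow> bool" where
  "linear_form_on V l \<longleftrightarrow>
     (\<forall>x\<in>V. \<forall>y\<in>V. l (x + y) = l x + l y) \<and> (\<forall>c. \<forall>x\<in>V. l (c *\<^sub>R x) = c * l x)"

definition riemannian_metric ::
    "('a, 'e::euclidean_space) chart set \<Rightarrow> ('a \<Rightarrow> 'a tvec \<Rightarrow> 'a tvec \<Rightarrow> real) \<Rightarrow> bool" where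
  "riemannian_metric \<A> g \<longleftrightarrow>
     (\<forall>p. let T = tangent_space \<A> p in
        (\<forall>x\<in>T. linear_form_on T (g p x)) \<and>
        (\<forall>x\<in>T. \<forall>y\<in>T. g p x y = g p y x) \<and>
        (\<forall>x\<in>T. x \<noteq> 0 \<longrightarrow> 0 < g p x x)) \<and>
     (\<forall>X\<in>vector_fields \<A>. \<forall>Y\<in>vector_fields \<A>.
        (\<lambda>p. g p (X p) (Y p)) \<in> smooth_functions \<A>)"

definition smooth_3_form ::
    "('a, 'e::euclidean_space) chart set \<Rightarrow>
     ('a \<Rightarrow> 'a tvec \<Rightarrow> 'a tvec \<Rightarrow> 'a tvec \<Rightarrow> real) \<Rightarrow> bool" where
  "smooth_3_form \<A> \<phi> \<longleftrightarrow>
     (\<forall>p. let T = tangent_space \<A> p in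
        (\<forall>x\<in>T. \<forall>y\<in>T. linear_form_on T (\<lambda>z. \<phi> p x y z)
           \<and> linear_form_on T (\<lambda>z. \<phi> p x z y) \<and> linear_form_on T (\<lambda>z. \<phi> p z x y)) \<and>
        (\<forall>x\<in>T. \<forall>y\<in>T. \<phi> p x x y = 0 \<and> \<phi> p x y x = 0 \<and> \<phi> p y x x = 0)) \<and>
     (\<forall>X\<in>vector_fields \<A>. \<forall>Y\<in>vector_fields \<A>. \<forall>Z\<in>vector_fields \<A>.
        (\<lambda>p. \<phi> p (X p) (Y p) (Z p)) \<in> smooth_functions \<A>)"

section \<open>Frames, orientations and the Hodge star\<close>

text \<open>A frame (ordered basis) of a 7-dimensional subspace \<open>V\<close> is a linear isomorphism from
  \<open>\<real>\<^sup>7\<close> onto \<open>V\<close>.  The index type \<open>7\<close> has elements \<open>1, \<dots>, 6\<close> and \<open>7 = 0\<close>.\<close>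

definition frame :: "'v::real_vector set \<Rightarrow> (real^7 \<Rightarrow> 'v) \<Rightarrow> bool" where
  "frame V u \<longleftrightarrow> linear u \<and> bij_betw u UNIV V"

definition vs_orientation :: "'v::real_vector set \<Rightarrow> (real^7 \<Rightarrow> 'v) set \<Rightarrow> bool" where
  "vs_orientation V P \<longleftrightarrow>
     (\<exists>f. frame V f \<and> P = {u. frame V u \<and> 0 < det (matrix (inv f \<circ> u))})"

text \<open>An orientation of the manifold: a choice of orientation of each tangent space which, near
  every point, is represented by a smooth frame field.\<close>

definition orientation ::
    "('a::topological_space, real^7) chart set \<Rightarrow> ('a \<Rightarrow> (real^7 \<Rightarrow> 'a tvec) set) \<Rightarrow> bool" where
  "orientation \<A> ori \<longleftrightarrow>
     (\<forall>p. vs_orientation (tangent_space \<A> p) (ori p)) \<and>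
     (\<forall>p. \<exists>U. open U \<and> p \<in> U \<and>
        (\<exists>X::7 \<Rightarrow> 'a \<Rightarrow> 'a tvec. (\<forall>i. X i \<in> vector_fields \<A>) \<and>
           (\<forall>q\<in>U. (\<lambda>x. \<Sum>i\<in>UNIV. (x $ i) *\<^sub>R X i q) \<in> ori q)))"

definition isometric_frame ::
    "('v::real_vector \<Rightarrow> 'v \<Rightarrow> real) \<Rightarrow> (real^7 \<Rightarrow> 'v) \<Rightarrow> bool" where
  "isometric_frame g u \<longleftrightarrow> (\<forall>x y. g (u x) (u y) = x \<bullet> y)"

text \<open>The Hodge star of a 3-form \<open>\<omega>\<close> on a 7-dimensional oriented inner product space.  With an
  oriented orthonormal basis \<open>E\<^sub>1, \<dots>, E\<^sub>7\<close>, whose volume form \<open>vol\<close> is the determinant of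
  coordinates, it is
  \<open>(*\<omega>)(w\<^sub>1, \<dots>, w\<^sub>4) = 1/3! \<Sum>\<^sub>i\<^sub>j\<^sub>k \<omega>(E\<^sub>i, E\<^sub>j, E\<^sub>k) vol(E\<^sub>i, E\<^sub>j, E\<^sub>k, w\<^sub>1, \<dots>, w\<^sub>4)\<close>,
  i.e. \<open>\<eta> \<and> *\<omega> = \<langle>\<eta>, \<omega>\<rangle> vol\<close>, which sends \<open>e\<^sup>1\<^sup>2\<^sup>3\<close> to \<open>e\<^sup>4\<^sup>5\<^sup>6\<^sup>7\<close>.  The value does not depend
  on the oriented orthonormal basis.\<close>

definition frame_vol ::
    "('v::real_vector \<Rightarrow> 'v \<Rightarrow> real) \<Rightarrow> (real^7 \<Rightarrow> 'v) \<Rightarrow> 'v^7 \<Rightarrow> real" where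
  "frame_vol g E w = det (\<chi> r c. g (E (axis r 1)) (w $ c))"

definition hodge_star_3 ::
    "('v::real_vector \<Rightarrow> 'v \<Rightarrow> real) \<Rightarrow> (real^7 \<Rightarrow> 'v) set \<Rightarrow>
     ('v \<Rightarrow> 'v \<Rightarrow> 'v \<Rightarrow> real) \<Rightarrow> 'v \<Rightarrow> 'v \<Rightarrow> 'v \<Rightarrow> 'v \<Rightarrow> real" where
  "hodge_star_3 g P \<omega> w1 w2 w3 w4 =
     (let E = (SOME E. E \<in> P \<and> isometric_frame g E); e = (\<lambda>i. E (axis i 1)) in
      1 / fact 3 * (\<Sum>i\<in>UNIV. \<Sum>j\<in>UNIV. \<Sum>k\<in>UNIV.
         \<omega> (e i) (e j) (e k) * frame_vol g E (vector [e i, e j, e k, w1, w2, w3, w4])))"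

definition wedge_1_2 ::
    "('v::real_vector \<Rightarrow> real) \<Rightarrow> ('v \<Rightarrow> 'v \<Rightarrow> real) \<Rightarrow> 'v \<Rightarrow> 'v \<Rightarrow> 'v \<Rightarrow> real" where
  "wedge_1_2 \<omega> \<eta> x1 x2 x3 =
     (let x = (vector [x1, x2, x3] :: 'v^3) in
      1 / (fact 1 * fact 2) * (\<Sum>\<sigma> | \<sigma> permutes (UNIV :: 3 set).
         of_int (sign \<sigma>) * \<omega> (x $ \<sigma> 1) * \<eta> (x $ \<sigma> 2) (x $ \<sigma> 3)))"

section \<open>Definite 3-forms\<close>

definition coord_3_form ::
    "7 \<Rightarrow> 7 \<Rightarrow> 7 \<Rightarrow> real^7 \<Rightarrow> real^7 \<Rightarrow> real^7 \<Rightarrow> real" where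
  "coord_3_form i j k x y z =
     det (vector [vector [x$i, x$j, x$k], vector [y$i, y$j, y$k], vector [z$i, z$j, z$k]]
       :: real^3^3)"

definition phi0 :: "real^7 \<Rightarrow> real^7 \<Rightarrow> real^7 \<Rightarrow> real" where
  "phi0 x y z =
     coord_3_form 1 2 3 x y z + coord_3_form 1 4 5 x y z + coord_3_form 1 6 7 x y z
     + coord_3_form 2 4 6 x y z - coord_3_form 2 5 7 x y z - coord_3_form 3 4 7 x y z
     - coord_3_form 3 5 6 x y z"

definition adapted_frame ::
    "'v::real_vector set \<Rightarrow> ('v \<Rightarrow> 'v \<Rightarrow> 'v \<Rightarrow> real) \<Rightarrow> (real^7 \<Rightarrow> 'v) \<Rightarrow> bool" where
  "adapted_frame V \<omega> u \<longleftrightarrow> frame V u \<and> (\<forall>x y z. \<omega> (u x) (u y) (u z) = phi0 x y z)"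

definition definite_3_form ::
    "('a, real^7) chart set \<Rightarrow> ('a \<Rightarrow> 'a tvec \<Rightarrow> 'a tvec \<Rightarrow> 'a tvec \<Rightarrow> real) \<Rightarrow> bool" where
  "definite_3_form \<A> \<phi> \<longleftrightarrow>
     smooth_3_form \<A> \<phi> \<and> (\<forall>p. \<exists>u. adapted_frame (tangent_space \<A> p) (\<phi> p) u)"

definition associated_metric ::
    "('a, real^7) chart set \<Rightarrow> ('a \<Rightarrow> 'a tvec \<Rightarrow> 'a tvec \<Rightarrow> 'a tvec \<Rightarrow> real) \<Rightarrow>
     ('a \<Rightarrow> 'a tvec \<Rightarrow> 'a tvec \<Rightarrow> real) \<Rightarrow> bool" where
  "associated_metric \<A> \<phi> g \<longleftrightarrow> riemannian_metric \<A> g \<and>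
     (\<forall>p u. adapted_frame (tangent_space \<A> p) (\<phi> p) u \<longrightarrow> isometric_frame (g p) u)"

definition associated_orientation ::
    "('a::topological_space, real^7) chart set \<Rightarrow>
     ('a \<Rightarrow> 'a tvec \<Rightarrow> 'a tvec \<Rightarrow> 'a tvec \<Rightarrow> real) \<Rightarrow> ('a \<Rightarrow> (real^7 \<Rightarrow> 'a tvec) set) \<Rightarrow> bool" where
  "associated_orientation \<A> \<phi> ori \<longleftrightarrow> orientation \<A> ori \<and>
     (\<forall>p u. adapted_frame (tangent_space \<A> p) (\<phi> p) u \<longrightarrow> u \<in> ori p)"

section \<open>The octonion algebra and the two twists\<close>

text \<open>The pair \<open>(a, \<alpha>)\<close> stands for \<open>a + \<alpha>\<close>.\<close>

type_synonym 'a oct = "('a \<Rightarrow> real) \<times> ('a \<Rightarrow> 'a tvec)"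

definition octonions :: "('a, real^7) chart set \<Rightarrow> 'a oct set" where
  "octonions \<A> = smooth_functions \<A> \<times> vector_fields \<A>"

definition cross ::
    "'v::real_vector set \<Rightarrow> ('v \<Rightarrow> 'v \<Rightarrow> real) \<Rightarrow> ('v \<Rightarrow> 'v \<Rightarrow> 'v \<Rightarrow> real) \<Rightarrow> 'v \<Rightarrow> 'v \<Rightarrow> 'v" where
  "cross V g \<omega> x y = (THE w. w \<in> V \<and> (\<forall>z\<in>V. g w z = \<omega> x y z))"

context
  fixes \<A> :: "('a, real^7) chart set"
    and g :: "'a \<Rightarrow> 'a tvec \<Rightarrow> 'a tvec \<Rightarrow> real"
    and \<phi> :: "'a \<Rightarrow> 'a tvec \<Rightarrow> 'a tvec \<Rightarrow> 'a tvec \<Rightarrow> real"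
begin

definition oct_mult :: "'a oct \<Rightarrow> 'a oct \<Rightarrow> 'a oct" where
  "oct_mult = (\<lambda>(a, \<alpha>) (b, \<beta>).
     (\<lambda>p. a p * b p - g p (\<alpha> p) (\<beta> p),
      \<lambda>p. a p *\<^sub>R \<beta> p + b p *\<^sub>R \<alpha> p + cross (tangent_space \<A> p) (g p) (\<phi> p) (\<alpha> p) (\<beta> p)))"

definition oct_one :: "'a oct" where
  "oct_one = (\<lambda>p. 1, \<lambda>p. 0)"

definition oct_inverse :: "'a oct \<Rightarrow> 'a oct" where
  "oct_inverse x = (THE y. y \<in> octonions \<A> \<and> oct_mult x y = oct_one \<and> oct_mult y x = oct_one)"

definition oct_form :: "'a oct \<Rightarrow> 'a oct \<Rightarrow> 'a \<Rightarrow> real" where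
  "oct_form = (\<lambda>(a, \<alpha>) (d, \<delta>) p. 2 * a p * d p + 2 * g p (\<alpha> p) (\<delta> p))"

definition vec_oct :: "('a \<Rightarrow> 'a tvec) \<Rightarrow> 'a oct" where
  "vec_oct \<alpha> = (\<lambda>p. 0, \<alpha>)"

text \<open>The extension of \<open>\<phi>(x, y, \<gamma>)\<close> to octonions \<open>x\<close>, \<open>y\<close>.\<close>

definition phi_oct :: "'a oct \<Rightarrow> 'a oct \<Rightarrow> ('a \<Rightarrow> 'a tvec) \<Rightarrow> 'a \<Rightarrow> real" where
  "phi_oct x y \<gamma> p = 1 / 2 * oct_form (oct_mult x y) (vec_oct \<gamma>) p"

definition algebraic_twist ::
    "'a oct \<Rightarrow> ('a \<Rightarrow> 'a tvec) \<Rightarrow> ('a \<Rightarrow> 'a tvec) \<Rightarrow> ('a \<Rightarrow> 'a tvec) \<Rightarrow> 'a \<Rightarrow> real" where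
  "algebraic_twist A \<alpha> \<beta> \<gamma> =
     phi_oct (oct_mult (vec_oct \<alpha>) A) (oct_mult (oct_inverse A) (vec_oct \<beta>)) \<gamma>"

end

text \<open>Forms are curried functions, so the interior product with \<open>v\<close> is application to \<open>v\<close>.\<close>

definition geometric_twist ::
    "('a \<Rightarrow> 'a tvec \<Rightarrow> 'a tvec \<Rightarrow> real) \<Rightarrow> ('a \<Rightarrow> (real^7 \<Rightarrow> 'a tvec) set) \<Rightarrow>
     ('a \<Rightarrow> 'a tvec \<Rightarrow> 'a tvec \<Rightarrow> 'a tvec \<Rightarrow> real) \<Rightarrow> 'a oct \<Rightarrow>
     'a \<Rightarrow> 'a tvec \<Rightarrow> 'a tvec \<Rightarrow> 'a tvec \<Rightarrow> real" where
  "geometric_twist g ori \<phi> = (\<lambda>(a, \<alpha>) p x y z.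
     ((a p)\<^sup>2 - g p (\<alpha> p) (\<alpha> p)) * \<phi> p x y z
     - 2 * a p * hodge_star_3 (g p) (ori p) (\<phi> p) (\<alpha> p) x y z
     + 2 * wedge_1_2 (g p (\<alpha> p)) (\<phi> p (\<alpha> p)) x y z)"

end

theory Submission
  imports Defs
begin

text \<open>
  Both twists are tensorial, so it suffices to compare them at a point in an adapted frame, where
  the metric, the 3-form and its Hodge dual become the standard ones on \<open>\<real>\<^sup>7\<close>.  Write
  \<open>A = r + v\<close>.  The part of \<open>(x A)(A\<^sup>-\<^sup>1 y)\<close> linear in \<open>r\<close> is the associator of \<open>x\<close>, \<open>v\<close>, \<open>y\<close>,
  whose inner product with \<open>z\<close> is \<open>-2 (*\<phi>)(v, x, y, z)\<close>.  The part without \<open>r\<close> reduces, through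
  \<open>(x \<times> v) \<times> (v \<times> y)\<close> and the polarised identity \<open>x \<times> (x \<times> y) = \<langle>x, y\<rangle> x - |x|\<^sup>2 y\<close>, to
  \<open>2 v\<^sup>\<flat> \<and> (v \<lrcorner> \<phi>) - |v|\<^sup>2 \<phi>\<close>.  The coefficients agree without using \<open>r\<^sup>2 + |v|\<^sup>2 = 1\<close>, which
  enters only through \<open>A\<^sup>-\<^sup>1 = r - v\<close>.
\<close>

section \<open>The index type of seven elements\<close>

lemma exhaust_7: "x = 1 \<or> x = 2 \<or> x = 3 \<or> x = 4 \<or> x = 5 \<or> x = 6 \<or> x = 7" for x :: 7
proof (induct x)
  case (of_int z)
  \<comment> \<open>The representatives run from 0 to 6, and 0 is the element
    \<open>7\<close>.\<close>
  then have "z = 0 \<or> z = 1 \<or> z = 2 \<or> z = 3 \<or> z = 4 \<or> z = 5 \<or> z = 6" by fastforce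
  then show ?case by auto
qed

lemma UNIV_7: "UNIV = {1, 2, 3, 4, 5, 6, 7::7}"
  using exhaust_7 by auto

lemma sum_7: "sum f (UNIV::7 set) = f 1 + f 2 + f 3 + f 4 + f 5 + f 6 + f 7"
  unfolding UNIV_7 by (simp add: ac_simps)

lemma forall_7: "(\<forall>i::7. P i) \<longleftrightarrow> P 1 \<and> P 2 \<and> P 3 \<and> P 4 \<and> P 5 \<and> P 6 \<and> P 7"
  by (metis exhaust_7)

lemma vector_7 [simp]:
  "(vector [a, b, c, d, e, f, g] :: 'a::zero^7) $ 1 = a"
  "(vector [a, b, c, d, e, f, g] :: 'a::zero^7) $ 2 = b"
  "(vector [a, b, c, d, e, f, g] :: 'a::zero^7) $ 3 = c"
  "(vector [a, b, c, d, e, f, g] :: 'a::zero^7) $ 4 = d"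
  "(vector [a, b, c, d, e, f, g] :: 'a::zero^7) $ 5 = e"
  "(vector [a, b, c, d, e, f, g] :: 'a::zero^7) $ 6 = f"
  "(vector [a, b, c, d, e, f, g] :: 'a::zero^7) $ 7 = g"
  unfolding vector_def by simp_all

section \<open>The Hodge dual of the standard 3-form\<close>

abbreviation det7 ::
    "real^7 \<Rightarrow> real^7 \<Rightarrow> real^7 \<Rightarrow> real^7 \<Rightarrow> real^7 \<Rightarrow> real^7 \<Rightarrow> real^7 \<Rightarrow> real" where
  "det7 a b c d e f g \<equiv> det (vector [a, b, c, d, e, f, g] :: real^7^7)"

text \<open>This is the value of e^{ijkl}, a 4 by 4 minor expanded along \<open>w\<close>. As an
  explicit polynomial it lets later identities be settled by comparing monomials.\<close>

definition coord_4_form ::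
    "7 \<Rightarrow> 7 \<Rightarrow> 7 \<Rightarrow> 7 \<Rightarrow> real^7 \<Rightarrow> real^7 \<Rightarrow> real^7 \<Rightarrow> real^7 \<Rightarrow> real" where
  "coord_4_form i j k l w x y z =
     w$i * (x$j * (y$k * z$l - y$l * z$k) - x$k * (y$j * z$l - y$l * z$j)
       + x$l * (y$j * z$k - y$k * z$j))
     - w$j * (x$i * (y$k * z$l - y$l * z$k) - x$k * (y$i * z$l - y$l * z$i)
       + x$l * (y$i * z$k - y$k * z$i))
     + w$k * (x$i * (y$j * z$l - y$l * z$j) - x$j * (y$i * z$l - y$l * z$i)
       + x$l * (y$i * z$j - y$j * z$i))
     - w$l * (x$i * (y$j * z$k - y$k * z$j) - x$j * (y$i * z$k - y$k * z$i)
       + x$k * (y$i * z$j - y$j * z$i))"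

text \<open>In the Leibniz sum only permutations fixing 1, 2 and 3 survive, which leaves the minor
  of the last four rows and columns.\<close>

lemma det_axis_123:
  "det7 (axis 1 1) (axis 2 1) (axis 3 1) w x y z = coord_4_form 4 5 6 7 w x y z"
  (is "det ?M = _")
proof -
  let ?t = "\<lambda>p. of_int (sign p) * (\<Prod>i\<in>UNIV. ?M $ i $ p i)"
  have prod: "(\<Prod>i\<in>UNIV. ?M $ i $ p i) = axis 1 1 $ p 1 * axis 2 1 $ p 2 * axis 3 1 $ p 3 *
      (w $ p 4 * x $ p 5 * y $ p 6 * z $ p 7)" for p
    unfolding UNIV_7 by (simp add: mult.assoc)
  have "det ?M = (\<Sum>p | p permutes {4, 5, 6, 7}. ?t p)"
    unfolding det_def
  proof (rule sum.mono_neutral_right)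
    show "{p. p permutes {4,5,6,7::7}} \<subseteq> {p. p permutes UNIV}"
      by (auto intro: permutes_subset)
    show "\<forall>p\<in>{p. p permutes UNIV} - {p. p permutes {4,5,6,7}}. ?t p = 0"
    proof
      fix p :: "7 \<Rightarrow> 7" assume p: "p \<in> {p. p permutes UNIV} - {p. p permutes {4,5,6,7}}"
      have "\<not> (p 1 = 1 \<and> p 2 = 2 \<and> p 3 = 3)"
      proof
        assume "p 1 = 1 \<and> p 2 = 2 \<and> p 3 = 3"
        then have "i \<notin> {4,5,6,7} \<Longrightarrow> p i = i" for i
          using exhaust_7[of i] by auto
        then have "p permutes {4,5,6,7}" using p by (auto simp: permutes_def)
        with p show False by blast
      qed
      then show "?t p = 0" unfolding prod by (auto simp: axis_def)
    qed
  qed (simp add: finite_permutations)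
  also have "\<dots> = coord_4_form 4 5 6 7 w x y z"
    unfolding prod
    by (subst sum_over_permutations_insert, simp, simp)+
      (simp add: permutes_sing sign_swap_id permutation_swap_id permutation_compose sign_compose
        sign_id swap_id_eq axis_def coord_4_form_def, simp add: algebra_simps)
  finally show ?thesis .
qed

text \<open>Permuting the columns by \<open>p\<close> turns the first three rows into the axes 1, 2,
  3, the case already computed. The sign is 1 or -1, hence its own inverse, and may change
  sides.\<close>

lemma det_axis_permute:
  assumes p: "p permutes UNIV" and i: "i = p 1" "j = p 2" "k = p 3"
  shows "det7 (axis i 1) (axis j 1) (axis k 1) w x y z =
    of_int (sign p) * coord_4_form (p 4) (p 5) (p 6) (p 7) w x y z"
proof -
  let ?M = "vector [axis i 1, axis j 1, axis k 1, w, x, y, z] :: real^7^7"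
  have inj: "p a = p b \<longleftrightarrow> a = b" for a b using permutes_inj[OF p] by (auto dest: injD)
  have "(\<chi> r c. ?M $ r $ p c) = vector [axis 1 1, axis 2 1, axis 3 1,
     \<chi> c. w $ p c, \<chi> c. x $ p c, \<chi> c. y $ p c, \<chi> c. z $ p c]"
    unfolding vec_eq_iff forall_7[where P = "\<lambda>i. \<forall>j. _ $ i $ j = _ i j"]
    by (simp add: i axis_def inj forall_7)
  with det_permute_columns[OF p, of ?M]
  have "of_int (sign p) * det ?M = coord_4_form (p 4) (p 5) (p 6) (p 7) w x y z"
    by (simp add: det_axis_123) (simp add: coord_4_form_def)
  then show ?thesis by (cases p rule: sign_cases) auto
qed

text \<open>The coordinate formula for the Hodge dual of \<open>phi0\<close>;
  \<open>hodge_phi0\<close> and \<open>hodge_star_adapted\<close> justify the name.\<close>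

definition psi0 :: "real^7 \<Rightarrow> real^7 \<Rightarrow> real^7 \<Rightarrow> real^7 \<Rightarrow> real" where
  "psi0 w x y z =
     coord_4_form 4 5 6 7 w x y z + coord_4_form 2 3 6 7 w x y z + coord_4_form 2 3 4 5 w x y z
     + coord_4_form 1 3 5 7 w x y z - coord_4_form 1 3 4 6 w x y z - coord_4_form 1 2 5 6 w x y z
     - coord_4_form 1 2 4 7 w x y z"

text \<open>In each term the permutation carrying \<open>1, 2, 3\<close> to \<open>i, j, k\<close> is a product of two or three
  transpositions, and the remaining values index the coordinate 4-form.\<close>

lemma star_phi0_det:
  fixes w x y z :: "real^7"
  defines "T \<equiv> \<lambda>i j k. det7 (axis i 1) (axis j 1) (axis k 1) w x y z"
  shows "T 1 2 3 + T 1 4 5 + T 1 6 7 + T 2 4 6 - T 2 5 7 - T 3 4 7 - T 3 5 6 = psi0 w x y z"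
proof -
  note swap = permutes_swap_id[OF UNIV_I UNIV_I]
  note swap2 = permutes_compose[OF swap swap]
  note swap3 = permutes_compose[OF swap swap2]
  note [simp] = swap_id_eq sign_swap_id permutation_swap_id permutation_compose sign_compose
  have 1: "T 1 2 3 = coord_4_form 4 5 6 7 w x y z"
    unfolding T_def by (rule det_axis_123)
  have 2: "T 1 4 5 = coord_4_form 2 3 6 7 w x y z"
    using det_axis_permute[OF swap2, of _ 2 4 3 5]
    by (simp add: T_def)
  have 3: "T 1 6 7 = coord_4_form 4 5 2 3 w x y z"
    using det_axis_permute[OF swap2, of _ 2 6 3 7]
    by (simp add: T_def)
  have 4: "T 2 4 6 = - coord_4_form 1 5 3 7 w x y z"
    using det_axis_permute[OF swap3, of _ 1 2 2 4 3 6]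
    by (simp add: T_def)
  have 5: "T 2 5 7 = - coord_4_form 4 1 6 3 w x y z"
    using det_axis_permute[OF swap3, of _ 1 2 2 5 3 7]
    by (simp add: T_def)
  have 6: "T 3 4 7 = - coord_4_form 2 5 6 1 w x y z"
    using det_axis_permute[OF swap3, of _ 1 3 3 7 2 4]
    by (simp add: T_def)
  have 7: "T 3 5 6 = - coord_4_form 4 2 1 7 w x y z"
    using det_axis_permute[OF swap3, of _ 1 3 3 6 2 5]
    by (simp add: T_def)
  show ?thesis unfolding 1 2 3 4 5 6 7 psi0_def
    by (simp add: coord_4_form_def algebra_simps)
qed

section \<open>Coordinate expansion and multilinearity of the standard 3-form\<close>

lemma coord_3_form_expand:
  "coord_3_form i j k x y z = x$i * (y$j * z$k - y$k * z$j) - x$j * (y$i * z$k - y$k * z$i)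
     + x$k * (y$i * z$j - y$j * z$i)"
  by (simp add: coord_3_form_def det_3 algebra_simps)

lemma phi0_linear:
  "phi0 (x + x') y z = phi0 x y z + phi0 x' y z" "phi0 (c *\<^sub>R x) y z = c * phi0 x y z"
  "phi0 x (y + y') z = phi0 x y z + phi0 x y' z" "phi0 x (c *\<^sub>R y) z = c * phi0 x y z"
  "phi0 x y (z + z') = phi0 x y z + phi0 x y z'" "phi0 x y (c *\<^sub>R z) = c * phi0 x y z"
  "phi0 (- x) y z = - phi0 x y z" "phi0 x (- y) z = - phi0 x y z"
  "phi0 (x - x') y z = phi0 x y z - phi0 x' y z" "phi0 x (y - y') z = phi0 x y z - phi0 x y' z"
  by (simp_all add: phi0_def coord_3_form_expand algebra_simps)

section \<open>The cross product on seven-dimensional space\<close>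

text \<open>The components make this the vector that represents the functional
  \<open>phi0 x y\<close> under the inner product.\<close>

definition cross0 :: "real^7 \<Rightarrow> real^7 \<Rightarrow> real^7" where
  "cross0 x y = (\<chi> i. phi0 x y (axis i 1))"

lemma inner_7:
  "(x::real^7) \<bullet> y = x$1 * y$1 + x$2 * y$2 + x$3 * y$3 + x$4 * y$4 + x$5 * y$5 + x$6 * y$6
     + x$7 * y$7"
  by (simp add: inner_vec_def sum_7)

lemma cross0_nth:
  "cross0 x y $ 1 = x$2 * y$3 - x$3 * y$2 + x$4 * y$5 - x$5 * y$4 + x$6 * y$7 - x$7 * y$6"
  "cross0 x y $ 2 = x$3 * y$1 - x$1 * y$3 + x$4 * y$6 - x$6 * y$4 - x$5 * y$7 + x$7 * y$5"
  "cross0 x y $ 3 = x$1 * y$2 - x$2 * y$1 - x$4 * y$7 + x$7 * y$4 - x$5 * y$6 + x$6 * y$5"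
  "cross0 x y $ 4 = x$5 * y$1 - x$1 * y$5 + x$6 * y$2 - x$2 * y$6 - x$7 * y$3 + x$3 * y$7"
  "cross0 x y $ 5 = x$1 * y$4 - x$4 * y$1 - x$7 * y$2 + x$2 * y$7 - x$6 * y$3 + x$3 * y$6"
  "cross0 x y $ 6 = x$7 * y$1 - x$1 * y$7 + x$2 * y$4 - x$4 * y$2 - x$3 * y$5 + x$5 * y$3"
  "cross0 x y $ 7 = x$1 * y$6 - x$6 * y$1 - x$2 * y$5 + x$5 * y$2 - x$3 * y$4 + x$4 * y$3"
  by (simp_all add: cross0_def phi0_def coord_3_form_expand axis_def)

lemma cross0_inner: "cross0 x y \<bullet> z = phi0 x y z"
  by (simp add: inner_7 cross0_nth phi0_def coord_3_form_expand algebra_simps)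

lemma cross0_linear:
  "cross0 (x + x') y = cross0 x y + cross0 x' y" "cross0 (c *\<^sub>R x) y = c *\<^sub>R cross0 x y"
  "cross0 x (y + y') = cross0 x y + cross0 x y'" "cross0 x (c *\<^sub>R y) = c *\<^sub>R cross0 x y"
  "cross0 (- x) y = - cross0 x y" "cross0 x (- y) = - cross0 x y"
  "cross0 (x - x') y = cross0 x y - cross0 x' y" "cross0 x (y - y') = cross0 x y - cross0 x y'"
  by (simp_all add: cross0_def vec_eq_iff phi0_linear)

lemma cross0_anticommute: "cross0 y x = - cross0 x y"
  by (simp add: vec_eq_iff forall_7 cross0_nth)

lemma cross0_same [simp]: "cross0 x x = 0"
  by (simp add: vec_eq_iff forall_7 cross0_nth)

lemma phi0_alternating: "phi0 y x z = - phi0 x y z" "phi0 x z y = - phi0 x y z"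
  by (simp_all add: phi0_def coord_3_form_expand algebra_simps)

lemma phi0_same [simp]: "phi0 x x z = 0" "phi0 x z x = 0" "phi0 z x x = 0"
  by (simp_all add: phi0_def coord_3_form_expand algebra_simps)

text \<open>In octonion terms this is the alternative law x(xy) = (xx)y for imaginary x and
  y.\<close>

lemma cross0_cross0_same: "cross0 x (cross0 x y) = (x \<bullet> y) *\<^sub>R x - (x \<bullet> x) *\<^sub>R y"
  by (simp add: vec_eq_iff forall_7 cross0_nth inner_7) (simp add: algebra_simps)

text \<open>Polarisation of the preceding identity. It interchanges the two left factors of a nested
  product, up to multiples of the three vectors.\<close>

lemma cross0_cross0_polar:
  "cross0 x (cross0 y z) = (x \<bullet> z) *\<^sub>R y + (y \<bullet> z) *\<^sub>R x - (2 * (x \<bullet> y)) *\<^sub>R z - cross0 y (cross0 x z)"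
  using cross0_cross0_same[of "x + y" z] cross0_cross0_same[of x z] cross0_cross0_same[of y z]
  by (simp add: cross0_linear inner_add_left inner_add_right inner_commute[of y x] algebra_simps)

text \<open>With p = \<open>cross0 x v\<close>, polarisation moves p past \<open>v\<close> and
  leaves \<open>v\<close> times p times \<open>y\<close>. A second polarisation expands p times
  \<open>y\<close>, after which the repeated factor \<open>v\<close> is absorbed by
  \<open>cross0_cross0_same\<close>.\<close>

lemma cross0_sandwich:
  "cross0 (cross0 x v) (cross0 v y) =
    (v \<bullet> v) *\<^sub>R cross0 x y - (v \<bullet> x) *\<^sub>R cross0 v y + (v \<bullet> y) *\<^sub>R cross0 v x - (2 * phi0 v x y) *\<^sub>R v"
proof -
  let ?p = "cross0 x v"
  \<comment> \<open>Two sign changes give the right-nested form that the polarised identity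
    requires.\<close>
  have "cross0 ?p y = cross0 y (cross0 v x)"
    using cross0_anticommute[of y ?p] cross0_anticommute[of v x] by (simp add: cross0_linear)
  also have "\<dots> = (y \<bullet> x) *\<^sub>R v + (v \<bullet> x) *\<^sub>R y - (2 * (y \<bullet> v)) *\<^sub>R x + cross0 v (cross0 x y)"
    using cross0_anticommute[of x y] by (simp add: cross0_cross0_polar[of y v x] cross0_linear)
  finally have "cross0 v (cross0 ?p y) = (v \<bullet> x) *\<^sub>R cross0 v y - (2 * (y \<bullet> v)) *\<^sub>R cross0 v x
      + (phi0 x y v *\<^sub>R v - (v \<bullet> v) *\<^sub>R cross0 x y)"
    by (simp add: cross0_linear cross0_cross0_same inner_commute[of v "cross0 x y"] cross0_inner)
  moreover have "phi0 x y v = phi0 v x y"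
    using phi0_alternating(2)[of x y v] phi0_alternating(1)[of x v y] by linarith
  moreover have "?p \<bullet> v = 0" "?p \<bullet> y = - phi0 v x y" "?p = - cross0 v x"
    by (simp_all add: cross0_inner phi0_alternating(1)[of x v] cross0_anticommute[of x v])
  ultimately have "cross0 ?p (cross0 v y) = - phi0 v x y *\<^sub>R v - (v \<bullet> y) *\<^sub>R cross0 v x
      - ((v \<bullet> x) *\<^sub>R cross0 v y - (2 * (v \<bullet> y)) *\<^sub>R cross0 v x
        + (phi0 v x y *\<^sub>R v - (v \<bullet> v) *\<^sub>R cross0 x y))"
    using cross0_cross0_polar[of ?p v y] by (simp only: inner_commute[of y v]) simp
  then show ?thesis by (simp add: vec_eq_iff algebra_simps)
qed

text \<open>The left side is the associator (xv)y - x(vy) of imaginary octonions; its real part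
  cancels by cyclic symmetry of \<open>phi0\<close>. Equality is a polynomial identity in each
  component.\<close>

lemma associator_cross:
  "cross0 (cross0 x v) y - cross0 x (cross0 v y) - (x \<bullet> v) *\<^sub>R y + (v \<bullet> y) *\<^sub>R x =
    (\<chi> i. -2 * psi0 v x y (axis i 1))"
  unfolding vec_eq_iff forall_7
  by (simp add: cross0_nth inner_7 psi0_def coord_4_form_def axis_def) (simp add: algebra_simps)

lemma psi0_axis:
  "psi0 v x y z = (\<chi> i. psi0 v x y (axis i 1)) \<bullet> z"
  unfolding psi0_def coord_4_form_def inner_7
  by (simp add: axis_def) (simp add: algebra_simps)

section \<open>Independence of the Hodge star from the frame\<close>

lemma det7_linear:
  "det7 (a + a') b c w x y z = det7 a b c w x y z + det7 a' b c w x y z"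
  "det7 a (b + b') c w x y z = det7 a b c w x y z + det7 a b' c w x y z"
  "det7 a b (c + c') w x y z = det7 a b c w x y z + det7 a b c' w x y z"
  "det7 (r *\<^sub>R a) b c w x y z = r * det7 a b c w x y z"
  "det7 a (r *\<^sub>R b) c w x y z = r * det7 a b c w x y z"
  "det7 a b (r *\<^sub>R c) w x y z = r * det7 a b c w x y z"
proof -
  let ?M = "vector [a, b, c, w, x, y, z] :: real^7^7"
  have eq: "(\<chi> i. if i = 1 then t else ?M $ i) = vector [t, b, c, w, x, y, z]"
    "(\<chi> i. if i = 2 then t else ?M $ i) = vector [a, t, c, w, x, y, z]"
    "(\<chi> i. if i = 3 then t else ?M $ i) = vector [a, b, t, w, x, y, z]" for t
    by (simp_all add: vec_eq_iff[where 'a = "real^7"] forall_7)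
  show "det7 (a + a') b c w x y z = det7 a b c w x y z + det7 a' b c w x y z"
    "det7 a (b + b') c w x y z = det7 a b c w x y z + det7 a b' c w x y z"
    "det7 a b (c + c') w x y z = det7 a b c w x y z + det7 a b c' w x y z"
    using det_row_add[of 1 "\<lambda>_. a" "\<lambda>_. a'" "\<lambda>i. ?M $ i"]
      det_row_add[of 2 "\<lambda>_. b" "\<lambda>_. b'" "\<lambda>i. ?M $ i"]
      det_row_add[of 3 "\<lambda>_. c" "\<lambda>_. c'" "\<lambda>i. ?M $ i"]
    by (simp_all only: eq)
  show "det7 (r *\<^sub>R a) b c w x y z = r * det7 a b c w x y z"
    "det7 a (r *\<^sub>R b) c w x y z = r * det7 a b c w x y z"
    "det7 a b (r *\<^sub>R c) w x y z = r * det7 a b c w x y z"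
    using det_row_mul[of 1 r "\<lambda>_. a" "\<lambda>i. ?M $ i"] det_row_mul[of 2 r "\<lambda>_. b" "\<lambda>i. ?M $ i"]
      det_row_mul[of 3 r "\<lambda>_. c" "\<lambda>i. ?M $ i"]
    by (simp_all only: eq scalar_mult_eq_scaleR)
qed

lemma det7_swap:
  "det7 b a c w x y z = - det7 a b c w x y z"
  "det7 a c b w x y z = - det7 a b c w x y z"
proof -
  let ?M = "vector [a, b, c, w, x, y, z] :: real^7^7"
  have eq: "(\<chi> i. ?M $ Transposition.transpose 1 2 i) = vector [b, a, c, w, x, y, z]"
    "(\<chi> i. ?M $ Transposition.transpose 2 3 i) = vector [a, c, b, w, x, y, z]"
    by (simp_all add: vec_eq_iff[where 'a = "real^7"] forall_7 swap_id_eq)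
  note swap = permutes_swap_id[OF UNIV_I UNIV_I]
  show "det7 b a c w x y z = - det7 a b c w x y z"
    using det_permute_rows[OF swap, of ?M 1 2] by (simp add: eq sign_swap_id)
  show "det7 a c b w x y z = - det7 a b c w x y z"
    using det_permute_rows[OF swap, of ?M 2 3] by (simp add: eq sign_swap_id)
qed

lemma sum_axis:
  fixes T :: "'n::finite \<Rightarrow> real"
  shows "(\<Sum>i\<in>UNIV. axis i 1 $ a * T i) = T a"
  by (simp add: axis_def if_distrib[of "\<lambda>x. x * _"] cong: if_cong)

text \<open>On axis vectors the coordinate form is a signed sum of six products of Kronecker deltas.
  Each selects one rearrangement of \<open>T a b c\<close>, and antisymmetry makes all six
  contributions equal. The factor 6 cancels the 1/3! of the Hodge star.\<close>

lemma sum_coord_3_form: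
  assumes s12: "\<And>i j k. T j i k = - T i j k" and s23: "\<And>i j k. T i k j = - T i j k"
  shows "(\<Sum>i\<in>UNIV. \<Sum>j\<in>UNIV. \<Sum>k\<in>UNIV.
      coord_3_form a b c (axis i 1) (axis j 1) (axis k 1) * T i j k) = 6 * T a b c"
proof -
  have *: "(\<Sum>i\<in>UNIV. \<Sum>j\<in>UNIV. \<Sum>k\<in>UNIV.
      axis i 1 $ a * (axis j 1 $ b * (axis k 1 $ c * T i j k))) = T a b c" for a b c
    by (simp only: sum_axis sum_distrib_left[symmetric])
  have "(\<Sum>i\<in>UNIV. \<Sum>j\<in>UNIV. \<Sum>k\<in>UNIV.
      coord_3_form a b c (axis i 1) (axis j 1) (axis k 1) * T i j k) =
     T a b c - T a c b - (T b a c - T b c a) + (T c a b - T c b a)"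
    by (simp add: coord_3_form_expand right_diff_distrib distrib_right left_diff_distrib
        sum.distrib sum_subtractf mult.assoc *)
  also have "\<dots> = 6 * T a b c"
    using s12[of b a c] s23[of a c b] s12[of b c a] s23[of b a c] s12[of c a b]
      s12[of c b a] s23[of c a b] s23[of b c a] by linarith
  finally show ?thesis .
qed

lemma hodge_phi0:
  fixes w x y z :: "real^7"
  shows "(\<Sum>i\<in>UNIV. \<Sum>j\<in>UNIV. \<Sum>k\<in>UNIV. phi0 (axis i 1) (axis j 1) (axis k 1) *
      det7 (axis i 1) (axis j 1) (axis k 1) w x y z) = 6 * psi0 w x y z"
proof -
  let ?T = "\<lambda>i j k. det7 (axis i 1) (axis j 1) (axis k 1) w x y z"
  note S = sum_coord_3_form[of ?T, OF det7_swap]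
  show ?thesis
    unfolding phi0_def distrib_right left_diff_distrib sum.distrib sum_subtractf S
      star_phi0_det[symmetric]
    by simp
qed

text \<open>The trace of a bilinear form is the same in every orthonormal basis: expanding the new
  basis in the old one produces the coefficients of R R^T, the identity matrix.\<close>

lemma bilinear_trace_orthogonal:
  fixes T :: "real^'n \<Rightarrow> real^'n \<Rightarrow> real" and r :: "real^'n \<Rightarrow> real^'n"
  assumes T: "bilinear T" and r: "orthogonal_transformation r"
  shows "(\<Sum>i\<in>UNIV. T (r (axis i 1)) (r (axis i 1))) = (\<Sum>i\<in>UNIV. T (axis i 1) (axis i 1))"
proof -
  let ?R = "matrix r"
  have lin: "linear r" and "orthogonal_matrix ?R"
    using r by (auto simp: orthogonal_transformation_matrix)
  then have RR: "?R ** transpose ?R = mat 1" by (simp add: orthogonal_matrix_def)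
  have r_axis: "r (axis i 1) = (\<Sum>j\<in>UNIV. (?R $ j $ i) *\<^sub>R axis j 1)" for i
    unfolding matrix_def by (simp add: basis_expansion scalar_mult_eq_scaleR[symmetric])
  have "(\<Sum>i\<in>UNIV. T (r (axis i 1)) (r (axis i 1))) =
      (\<Sum>i\<in>UNIV. \<Sum>(j, k)\<in>UNIV \<times> UNIV. (?R $ j $ i) * (?R $ k $ i) * T (axis j 1) (axis k 1))"
    unfolding r_axis bilinear_sum[OF T]
    by (simp add: bilinear_lmul[OF T] bilinear_rmul[OF T] mult_ac)
  also have "\<dots> = (\<Sum>(j, k)\<in>UNIV \<times> UNIV. (\<Sum>i\<in>UNIV. ?R $ j $ i * ?R $ k $ i) * T (axis j 1) (axis k 1))"
    by (subst sum.swap) (simp add: sum_distrib_right case_prod_unfold)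
  also have "\<dots> = (\<Sum>(j, k)\<in>UNIV \<times> UNIV. (?R ** transpose ?R) $ j $ k * T (axis j 1) (axis k 1))"
    by (simp add: matrix_matrix_mult_def transpose_def)
  also have "\<dots> = (\<Sum>i\<in>UNIV. T (axis i 1) (axis i 1))"
    unfolding RR sum.cartesian_product[symmetric]
    by (simp add: mat_def if_distrib[of "\<lambda>x. x * _"] cong: if_cong)
  finally show ?thesis .
qed

text \<open>Trace invariance removes \<open>r\<close> from one index at a time; between uses the
  sums are exchanged to bring the next index innermost.\<close>

lemma hodge_phi0_orthogonal:
  fixes r :: "real^7 \<Rightarrow> real^7" and w x y z :: "real^7"
  assumes r: "orthogonal_transformation r"
  shows "(\<Sum>i\<in>UNIV. \<Sum>j\<in>UNIV. \<Sum>k\<in>UNIV. phi0 (r (axis i 1)) (r (axis j 1)) (r (axis k 1)) *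
      det7 (r (axis i 1)) (r (axis j 1)) (r (axis k 1)) w x y z) = 6 * psi0 w x y z"
    (is "(\<Sum>i\<in>UNIV. \<Sum>j\<in>UNIV. \<Sum>k\<in>UNIV. ?F (r (axis i 1)) (r (axis j 1)) (r (axis k 1))) = _")
proof -
  let ?e = "\<lambda>i::7. axis i 1 :: real^7"
  \<comment> \<open>Each frame vector occurs once in \<open>phi0\<close> and once in
    \<open>det7\<close>. Naming the two occurrences separately exhibits the summand as the diagonal
    of a bilinear form.\<close>
  let ?B = "\<lambda>a b c a' b' c'. phi0 a b c * det7 a' b' c' w x y z"
  have bil: "bilinear (\<lambda>a a'. ?B a b c a' b' c')" "bilinear (\<lambda>b b'. ?B a b c a' b' c')"
     "bilinear (\<lambda>c c'. ?B a b c a' b' c')" for a b c a' b' c'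
    by (auto simp: bilinear_def linear_iff phi0_linear det7_linear algebra_simps)
  have "(\<Sum>i\<in>UNIV. \<Sum>j\<in>UNIV. \<Sum>k\<in>UNIV. ?F (r (?e i)) (r (?e j)) (r (?e k))) =
      (\<Sum>i\<in>UNIV. \<Sum>j\<in>UNIV. \<Sum>k\<in>UNIV. ?F (r (?e i)) (r (?e j)) (?e k))"
    by (simp only: bilinear_trace_orthogonal[OF bil(3) r])
  also have "\<dots> = (\<Sum>i\<in>UNIV. \<Sum>k\<in>UNIV. \<Sum>j\<in>UNIV. ?F (r (?e i)) (r (?e j)) (?e k))"
    by (rule sum.cong[OF refl], rule sum.swap)
  also have "\<dots> = (\<Sum>i\<in>UNIV. \<Sum>k\<in>UNIV. \<Sum>j\<in>UNIV. ?F (r (?e i)) (?e j) (?e k))"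
    by (simp only: bilinear_trace_orthogonal[OF bil(2) r])
  also have "\<dots> = (\<Sum>k\<in>UNIV. \<Sum>j\<in>UNIV. \<Sum>i\<in>UNIV. ?F (r (?e i)) (?e j) (?e k))"
    by (rule trans[OF sum.swap], rule sum.cong[OF refl], rule sum.swap)
  also have "\<dots> = (\<Sum>k\<in>UNIV. \<Sum>j\<in>UNIV. \<Sum>i\<in>UNIV. ?F (?e i) (?e j) (?e k))"
    by (simp only: bilinear_trace_orthogonal[OF bil(1) r])
  also have "\<dots> = (\<Sum>i\<in>UNIV. \<Sum>j\<in>UNIV. \<Sum>k\<in>UNIV. ?F (?e i) (?e j) (?e k))"
    by (rule trans[OF sum.cong[OF refl sum.swap]], rule trans[OF sum.swap], rule sum.cong[OF refl], rule sum.swap)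
  finally show ?thesis by (simp only: hodge_phi0)
qed

text \<open>This is the change of frame. \<open>inv f\<close> is a true inverse only on
  \<open>V\<close>, which is also the range of \<open>u\<close>; linearity then follows from
  injectivity of \<open>f\<close>.\<close>

lemma linear_inv_frame:
  assumes f: "frame V f" and u: "frame V u"
  shows "linear (inv f \<circ> u)" "f ((inv f \<circ> u) x) = u x"
proof -
  have lf: "linear f" and lu: "linear u" and inj: "inj f" and rng: "range f = V" "range u = V"
    using f u by (auto simp: frame_def bij_betw_def)
  have inv_f: "f (inv f (u x)) = u x" for x
    using rng by (metis f_inv_into_f rangeI)
  then show "f ((inv f \<circ> u) x) = u x" by simp
  have "f (inv f (u x + u y)) = u x + u y" "f (inv f (c *\<^sub>R u x)) = c *\<^sub>R u x" for x y c
    by (metis inv_f linear_add[OF lu]) (metis inv_f linear_scale[OF lu])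
  then show "linear (inv f \<circ> u)"
    by (intro linearI injD[OF inj])
      (simp_all add: inv_f linear_add[OF lf] linear_add[OF lu] linear_scale[OF lf] linear_scale[OF lu])
qed

text \<open>The orientation is given through a reference frame. Comparing both frames with it and
  using multiplicativity of the determinant removes that reference.\<close>

lemma oriented_frames_det_pos:
  assumes P: "vs_orientation V P" and u: "u \<in> P" and E: "E \<in> P"
  shows "0 < det (matrix (inv u \<circ> E))"
proof -
  obtain f where f: "frame V f" "P = {u. frame V u \<and> 0 < det (matrix (inv f \<circ> u))}"
    using P by (auto simp: vs_orientation_def)
  then have fr: "frame V u" "frame V E"
    and pos: "0 < det (matrix (inv f \<circ> u))" "0 < det (matrix (inv f \<circ> E))"
    using u E by auto
  have "inv f \<circ> E = (inv f \<circ> u) \<circ> (inv u \<circ> E)"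
    using linear_inv_frame(2)[OF fr] by (auto simp: fun_eq_iff)
  then have "det (matrix (inv f \<circ> E)) = det (matrix (inv f \<circ> u)) * det (matrix (inv u \<circ> E))"
    using matrix_compose[OF linear_inv_frame(1)[OF fr] linear_inv_frame(1)[OF f(1) fr(1)]]
    by (simp add: det_mul)
  with pos show ?thesis by (simp add: zero_less_mult_iff)
qed

text \<open>The star is computed in a chosen frame \<open>E\<close>, which is oriented and isometric
  but perhaps not adapted; \<open>u\<close> shows that such a frame exists. It differs from
  \<open>u\<close> by a rotation \<open>r\<close>, which preserves volume and drops out of the sum
  by trace invariance.\<close>

lemma hodge_star_adapted:
  assumes P: "vs_orientation V P" and uP: "u \<in> P" and iso: "isometric_frame g u"
    and ad: "adapted_frame V \<omega> u"
  shows "hodge_star_3 g P \<omega> (u w) (u x) (u y) (u z) = psi0 w x y z"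
proof -
  define E where "E = (SOME E. E \<in> P \<and> isometric_frame g E)"
  have E: "E \<in> P" "isometric_frame g E"
    using someI[of "\<lambda>E. E \<in> P \<and> isometric_frame g E" u] uP iso by (auto simp: E_def)
  define r where "r = inv u \<circ> E"
  have fr: "frame V u" "frame V E" using P uP E by (auto simp: vs_orientation_def)
  have lin: "linear r" and ur: "E a = u (r a)" for a
    using linear_inv_frame[OF fr] by (auto simp: r_def)
  have orth: "orthogonal_transformation r"
    using lin E(2) iso by (auto simp: orthogonal_transformation_def isometric_frame_def ur)
  have "det (matrix r) = 1"
    using oriented_frames_det_pos[OF P uP E(1)] det_orthogonal_matrix[of "matrix r"] orth
    \<comment> \<open>Orthogonality leaves 1 or -1, and the common orientation excludes -1.\<close>
    by (auto simp: orthogonal_transformation_matrix r_def)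
  then have vol: "frame_vol g E (vector [u a, u b, u c, u w, u x, u y, u z]) =
      det7 a b c w x y z" for a b c
  proof -
    let ?W = "vector [a, b, c, w, x, y, z] :: real^7^7"
    have "vector [u a, u b, u c, u w, u x, u y, u z] $ l = u (?W $ l)" for l
      using exhaust_7[of l] by auto
    \<comment> \<open>\<open>frame_vol\<close> places the vectors in columns and \<open>det7\<close>
      in rows, hence the transpose.\<close>
    then have "(\<chi> i l. g (E (axis i 1)) (vector [u a, u b, u c, u w, u x, u y, u z] $ l)) =
        transpose (?W ** matrix r)"
      using iso
      by (simp add: vec_eq_iff ur isometric_frame_def transpose_def
        matrix_matrix_mult_def matrix_def inner_vec_def mult.commute)
    then show ?thesis
      unfolding frame_vol_def by (simp add: det_mul \<open>det (matrix r) = 1\<close>)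
  qed
  have "hodge_star_3 g P \<omega> (u w) (u x) (u y) (u z) = 1 / fact 3 *
     (\<Sum>i\<in>UNIV. \<Sum>j\<in>UNIV. \<Sum>k\<in>UNIV. phi0 (r (axis i 1)) (r (axis j 1)) (r (axis k 1)) *
      det7 (r (axis i 1)) (r (axis j 1)) (r (axis k 1)) w x y z)"
    unfolding hodge_star_3_def Let_def E_def[symmetric] ur[of "axis _ _"] vol
    using ad by (simp add: adapted_frame_def)
  then show ?thesis
    by (simp add: hodge_phi0_orthogonal[OF orth] fact_numeral)
qed

section \<open>Octonions on the manifold\<close>

text \<open>Needed to see that the candidate inverse is again smooth. Agreement with the negative is
  required only on \<open>S\<close>, so that the induction applies to derivatives; these are
  determined inside \<open>S\<close> because \<open>S\<close> is open.\<close>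

lemma Ck_on_uminus:
  assumes "open S" "Ck_on k S f" "\<And>x. x \<in> S \<Longrightarrow> h x = - f x"
  shows "Ck_on k S h"
  using assms(2,3)
proof (induction k arbitrary: f h)
  case 0
  then show ?case
    using continuous_on_cong[OF refl, of S h "\<lambda>x. - f x"] by (simp add: continuous_on_minus)
next
  case (Suc k)
  have der: "(h has_derivative (\<lambda>v. - frechet_derivative f (at x) v)) (at x)" if "x \<in> S" for x
  proof (rule has_derivative_transform_within_open[OF _ \<open>open S\<close> that])
    show "((\<lambda>x. - f x) has_derivative (\<lambda>v. - frechet_derivative f (at x) v)) (at x)"
      using Suc.prems(1) that
      by (intro has_derivative_minus) (simp add: frechet_derivative_works)
  qed (simp add: Suc.prems(2))
  show ?case
    unfolding Ck_on.simps
  proof (intro conjI ballI allI)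
    show "h differentiable at x" if "x \<in> S" for x
      using der[OF that] by (rule differentiableI)
    show "Ck_on k S (\<lambda>x. frechet_derivative h (at x) v)" for v
    proof (rule Suc.IH)
      show "Ck_on k S (\<lambda>x. frechet_derivative f (at x) v)" using Suc.prems(1) by simp
      show "frechet_derivative h (at x) v = - frechet_derivative f (at x) v" if "x \<in> S" for x
        using frechet_derivative_at[OF der[OF that]] by metis
    qed
  qed
qed

lemma smooth_functions_uminus:
  assumes atlas: "smooth_atlas \<A>" and f: "f \<in> smooth_functions \<A>"
  shows "(\<lambda>p. - f p) \<in> smooth_functions \<A>"
  unfolding smooth_functions_def smooth_on_def
proof (clarify)
  fix U \<psi> k assume c: "(U, \<psi>) \<in> \<A>"
  have "open (\<psi> ` U)" using atlas c by (auto simp: smooth_atlas_def is_chart_def)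
  moreover have "Ck_on k (\<psi> ` U) (f \<circ> inv_into U \<psi>)"
    using f c by (auto simp: smooth_functions_def smooth_on_def)
  ultimately show "Ck_on k (\<psi> ` U) ((\<lambda>p. - f p) \<circ> inv_into U \<psi>)"
    by (rule Ck_on_uminus) simp
qed

lemma tangent_space_uminus:
  assumes "D \<in> tangent_space \<A> p"
  shows "- D \<in> tangent_space \<A> p"
  using assms by (simp add: tangent_space_def)

lemma vector_fields_uminus:
  assumes "smooth_atlas \<A>" "X \<in> vector_fields \<A>"
  shows "(\<lambda>p. - X p) \<in> vector_fields \<A>"
  using assms(2) smooth_functions_uminus[OF assms(1)]
  by (simp add: vector_fields_def tangent_space_uminus)

text \<open>\<open>cross0_inner\<close>, transported by \<open>u\<close>, gives existence for the
  definite description; nondegeneracy of the inner product gives uniqueness.\<close>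

lemma cross_adapted:
  assumes ad: "adapted_frame V \<omega> u" and iso: "isometric_frame g u"
  shows "cross V g \<omega> (u x) (u y) = u (cross0 x y)"
  unfolding cross_def
proof (rule the_equality)
  have V: "V = range u" and \<omega>: "\<And>x y z. \<omega> (u x) (u y) (u z) = phi0 x y z"
    and g: "\<And>x y. g (u x) (u y) = x \<bullet> y"
    using ad iso by (auto simp: adapted_frame_def frame_def bij_betw_def isometric_frame_def)
  show "u (cross0 x y) \<in> V \<and> (\<forall>z\<in>V. g (u (cross0 x y)) z = \<omega> (u x) (u y) z)"
    by (auto simp: V \<omega> g cross0_inner)
  fix w assume w: "w \<in> V \<and> (\<forall>z\<in>V. g w z = \<omega> (u x) (u y) z)"
  then obtain w' where w': "w = u w'" by (auto simp: V)
  with w have "w' \<bullet> z = cross0 x y \<bullet> z" for z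
    by (auto simp: V \<omega> g cross0_inner)
  then show "w = u (cross0 x y)" by (metis w' vector_eq_rdot)
qed

text \<open>The six permutations fall into pairs that exchange the two arguments of
  \<open>\<eta>\<close>. Skewness makes the terms of a pair equal, which cancels the factor
  1/2.\<close>

lemma wedge_1_2_skew:
  assumes "\<eta> y x = - \<eta> x y" "\<eta> z x = - \<eta> x z" "\<eta> z y = - \<eta> y z"
  shows "wedge_1_2 \<omega> \<eta> x y z = \<omega> x * \<eta> y z - \<omega> y * \<eta> x z + \<omega> z * \<eta> x y"
proof -
  have f: "finite {2, 3::3}" "1 \<notin> {2, 3::3}" "finite {3::3}" "2 \<notin> {3::3}" by auto
  show ?thesis
    unfolding wedge_1_2_def Let_def UNIV_3
    unfolding sum_over_permutations_insert[OF f(1,2)] sum_over_permutations_insert[OF f(3,4)]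
    by (simp add: assms permutes_sing sign_swap_id permutation_swap_id sign_compose sign_id swap_id_eq)
qed

section \<open>Products and inverses in an adapted frame\<close>

lemma oct_mult_adapted:
  assumes ad: "adapted_frame (tangent_space \<A> p) (\<phi> p) u" and iso: "isometric_frame (g p) u"
    and X: "snd X p = u x" and Y: "snd Y p = u y"
  shows "fst (oct_mult \<A> g \<phi> X Y) p = fst X p * fst Y p - x \<bullet> y"
    and "snd (oct_mult \<A> g \<phi> X Y) p = u (fst X p *\<^sub>R y + fst Y p *\<^sub>R x + cross0 x y)"
proof -
  have "linear u" using ad by (simp add: adapted_frame_def frame_def)
  then show "fst (oct_mult \<A> g \<phi> X Y) p = fst X p * fst Y p - x \<bullet> y"
    and "snd (oct_mult \<A> g \<phi> X Y) p = u (fst X p *\<^sub>R y + fst Y p *\<^sub>R x + cross0 x y)"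
    using iso X Y cross_adapted[OF ad iso]
    by (auto simp: oct_mult_def case_prod_beta isometric_frame_def linear_add linear_scale)
qed

text \<open>The two imaginary equations differ only in the sign of the cross product, which
  therefore vanishes. As \<open>r\<close> or \<open>v\<close> may be zero, nothing is divided: the
  relations are combined with weights r^2 and |v|^2, whose sum is 1.\<close>

lemma octonion_inverse_unique:
  fixes v w :: "real^7"
  assumes norm: "r\<^sup>2 + v \<bullet> v = 1" and re: "r * b - v \<bullet> w = 1"
    and im: "r *\<^sub>R w + b *\<^sub>R v + cross0 v w = 0" "b *\<^sub>R v + r *\<^sub>R w + cross0 w v = 0"
  shows "b = r" "w = - v"
proof -
  have "2 *\<^sub>R cross0 v w = 0"
    using im cross0_anticommute[of v w] by (simp add: scaleR_2 algebra_simps add_eq_0_iff2)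
  then have c: "cross0 v w = 0" by simp
  have lin: "r *\<^sub>R w + b *\<^sub>R v = 0" using im(1) c by simp
  have "r * (v \<bullet> w) + b * (v \<bullet> v) = v \<bullet> (r *\<^sub>R w + b *\<^sub>R v)" by (simp add: inner_add_right)
  then have "r * (v \<bullet> w) + b * (v \<bullet> v) = 0" by (simp add: lin)
  \<comment> \<open>The preceding relation replaces \<open>b\<close> times |v|^2, so that
    \<open>b\<close> becomes \<open>r\<close> times the real part of the product, which is
    1.\<close>
  moreover have "b = b * (r\<^sup>2 + v \<bullet> v)" by (simp add: norm)
  ultimately have "b = r * (r * b - v \<bullet> w)" by (simp add: algebra_simps power2_eq_square)
  then show b: "b = r" by (simp add: re)
  have "cross0 v (cross0 v w) = 0" using cross0_linear(4)[of v 0 0] by (simp add: c)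
  then have "(v \<bullet> v) *\<^sub>R w = (v \<bullet> w) *\<^sub>R v" by (simp add: cross0_cross0_same)
  also have "v \<bullet> w = - (v \<bullet> v)" using re norm by (simp add: b power2_eq_square)
  finally have 1: "(v \<bullet> v) *\<^sub>R w = - ((v \<bullet> v) *\<^sub>R v)" by simp
  have "r *\<^sub>R (r *\<^sub>R w + b *\<^sub>R v) = 0" by (simp add: lin)
  then have 2: "r\<^sup>2 *\<^sub>R w = - (r\<^sup>2 *\<^sub>R v)" by (simp add: b power2_eq_square algebra_simps add_eq_0_iff2)
  have "(r\<^sup>2 + v \<bullet> v) *\<^sub>R w = - ((r\<^sup>2 + v \<bullet> v) *\<^sub>R v)"
    using 1 2 by (simp add: scaleR_add_left)
  then show "w = - v" by (simp add: norm)
qed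

text \<open>The left side pairs \<open>z\<close> with the imaginary part of the product of xA and
  A^{-1}y, whose real parts are -x.v and v.y. The powers of \<open>r\<close> separate the cross
  product, the associator and the sandwich term.\<close>

lemma twist_R7:
  fixes v x y z :: "real^7"
  shows "(- (x \<bullet> v) *\<^sub>R (r *\<^sub>R y - cross0 v y) + (v \<bullet> y) *\<^sub>R (r *\<^sub>R x + cross0 x v)
      + cross0 (r *\<^sub>R x + cross0 x v) (r *\<^sub>R y - cross0 v y)) \<bullet> z =
    (r\<^sup>2 - v \<bullet> v) * phi0 x y z - 2 * r * psi0 v x y z
      + 2 * ((v \<bullet> x) * phi0 v y z - (v \<bullet> y) * phi0 v x z + (v \<bullet> z) * phi0 v x y)"
proof -
  have "r * ((cross0 (cross0 x v) y - cross0 x (cross0 v y) - (x \<bullet> v) *\<^sub>R y + (v \<bullet> y) *\<^sub>R x) \<bullet> z)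
      = - 2 * r * psi0 v x y z"
    unfolding associator_cross psi0_axis[of v x y z] by (simp add: inner_vec_def sum_distrib_left mult_ac)
  then show ?thesis
    by (simp add: cross0_linear cross0_sandwich inner_add_left inner_diff_left cross0_inner)
      (simp add: phi0_alternating(1)[of x v] inner_commute[of x v] power2_eq_square algebra_simps)
qed

lemma vector_field_frame:
  assumes "adapted_frame (tangent_space \<A> p) \<omega> u" "X \<in> vector_fields \<A>"
  obtains x where "X p = u x"
proof -
  have "X p \<in> range u"
    using assms by (auto simp: adapted_frame_def frame_def bij_betw_def vector_fields_def)
  then show ?thesis using that by blast
qed

text \<open>The inverse equations are pointwise, so a frame may be chosen at each point separately.
  Membership in \<open>octonions\<close> is where smoothness of the negated field enters.\<close>

lemma oct_inverse_eq:
  assumes atlas: "smooth_atlas \<A>" and def: "definite_3_form \<A> \<phi>" and met: "associated_metric \<A> \<phi> g"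
    and A: "(a, \<nu>) \<in> octonions \<A>" and norm: "oct_form g (a, \<nu>) (a, \<nu>) = (\<lambda>p. 2)"
  shows "oct_inverse \<A> g \<phi> (a, \<nu>) = (a, \<lambda>p. - \<nu> p)"
  unfolding oct_inverse_def
proof (rule the_equality)
  have a: "a \<in> smooth_functions \<A>" and \<nu>: "\<nu> \<in> vector_fields \<A>"
    using A by (auto simp: octonions_def)
  have frames: "\<exists>u v. adapted_frame (tangent_space \<A> p) (\<phi> p) u \<and> isometric_frame (g p) u \<and>
      \<nu> p = u v \<and> (a p)\<^sup>2 + v \<bullet> v = 1" for p
  proof -
    obtain u where u: "adapted_frame (tangent_space \<A> p) (\<phi> p) u"
      using def by (auto simp: definite_3_form_def)
    moreover have iso: "isometric_frame (g p) u"
      using met u by (auto simp: associated_metric_def)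
    moreover obtain v where "\<nu> p = u v"
      using vector_field_frame[OF u \<nu>] .
    moreover have "(a p)\<^sup>2 + v \<bullet> v = 1"
      using fun_cong[OF norm, of p] iso \<open>\<nu> p = u v\<close>
      by (simp add: oct_form_def isometric_frame_def power2_eq_square)
    ultimately show ?thesis by blast
  qed
  \<comment> \<open>Both orders of multiplication are treated at once, since the inverse is
    two-sided.\<close>
  have prod: "fst (oct_mult \<A> g \<phi> X Y) p = 1 \<and> snd (oct_mult \<A> g \<phi> X Y) p = 0"
    if XY: "X = (a, \<nu>) \<and> Y = (a, \<lambda>p. - \<nu> p) \<or> Y = (a, \<nu>) \<and> X = (a, \<lambda>p. - \<nu> p)" for X Y p
  proof -
    obtain u v where u: "adapted_frame (tangent_space \<A> p) (\<phi> p) u" "isometric_frame (g p) u"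
      "\<nu> p = u v" "(a p)\<^sup>2 + v \<bullet> v = 1" using frames by blast
    have lin: "linear u" using u(1) by (simp add: adapted_frame_def frame_def)
    note mult = oct_mult_adapted[of \<A> p \<phi> u g, OF u(1,2)]
    from mult[of X v Y "- v"] mult[of X "- v" Y v] XY u(3,4) show ?thesis
      by (auto simp: linear_neg[OF lin] linear_0[OF lin] cross0_linear power2_eq_square)
  qed
  show "(a, \<lambda>p. - \<nu> p) \<in> octonions \<A> \<and> oct_mult \<A> g \<phi> (a, \<nu>) (a, \<lambda>p. - \<nu> p) = oct_one \<and>
      oct_mult \<A> g \<phi> (a, \<lambda>p. - \<nu> p) (a, \<nu>) = oct_one"
    using prod a vector_fields_uminus[OF atlas \<nu>]
    by (auto simp: octonions_def oct_one_def prod_eq_iff fun_eq_iff[where 'a = 'a])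
  fix y assume y: "y \<in> octonions \<A> \<and> oct_mult \<A> g \<phi> (a, \<nu>) y = oct_one \<and>
      oct_mult \<A> g \<phi> y (a, \<nu>) = oct_one"
  have "fst y p = a p \<and> snd y p = - \<nu> p" for p
  proof -
    obtain u v where u: "adapted_frame (tangent_space \<A> p) (\<phi> p) u" "isometric_frame (g p) u"
      and v: "\<nu> p = u v" and n: "(a p)\<^sup>2 + v \<bullet> v = 1" using frames by blast
    note mult = oct_mult_adapted[of \<A> p \<phi> u g, OF u]
    have lin: "linear u" and inj: "inj u"
      using u(1) by (auto simp: adapted_frame_def frame_def bij_betw_def)
    obtain w where w: "snd y p = u w"
      using vector_field_frame[OF u(1), of "snd y"] y by (metis mem_Times_iff octonions_def)
    have u0: "u z = 0 \<longleftrightarrow> z = 0" for z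
      using inj lin by (metis injD linear_0)
    have "fst y p = a p \<and> w = - v"
      using octonion_inverse_unique[OF n, of "fst y p" w] y
        mult[of "(a, \<nu>)" v y w] mult[of y w "(a, \<nu>)" v]
      by (simp add: v w u0 oct_one_def)
    then show ?thesis by (simp add: w v linear_neg[OF lin])
  qed
  then show "y = (a, \<lambda>p. - \<nu> p)"
    by (auto simp: prod_eq_iff fun_eq_iff[where 'a = 'a])
qed

theorem theorem5p3:
  fixes \<A> :: "('a::{t2_space, second_countable_topology}, real^7) chart set"
    and g :: "'a \<Rightarrow> 'a tvec \<Rightarrow> 'a tvec \<Rightarrow> real"
    and \<phi> :: "'a \<Rightarrow> 'a tvec \<Rightarrow> 'a tvec \<Rightarrow> 'a tvec \<Rightarrow> real"
    and ori :: "'a \<Rightarrow> (real^7 \<Rightarrow> 'a tvec) set"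
    and A :: "'a oct"
  assumes "smooth_atlas \<A>"
    and "connected (UNIV :: 'a set)"
    and "definite_3_form \<A> \<phi>"
    and "associated_metric \<A> \<phi> g"
    and "associated_orientation \<A> \<phi> ori"
    and "A \<in> octonions \<A>"
    and "oct_form g A A = (\<lambda>p. 2)"
  shows "\<forall>\<alpha>\<in>vector_fields \<A>. \<forall>\<beta>\<in>vector_fields \<A>. \<forall>\<gamma>\<in>vector_fields \<A>.
    algebraic_twist \<A> g \<phi> A \<alpha> \<beta> \<gamma> = (\<lambda>p. geometric_twist g ori \<phi> A p (\<alpha> p) (\<beta> p) (\<gamma> p))"
proof (intro ballI ext)
  fix \<alpha> \<beta> \<gamma> p
  assume fields: "\<alpha> \<in> vector_fields \<A>" "\<beta> \<in> vector_fields \<A>" "\<gamma> \<in> vector_fields \<A>"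
  obtain a \<nu> where A: "A = (a, \<nu>)" by (cases A)
  have \<nu>: "\<nu> \<in> vector_fields \<A>" using assms(6) by (simp add: A octonions_def)
  \<comment> \<open>One frame serves the metric, the cross product and the Hodge star, because an
    adapted frame is isometric and oriented.\<close>
  obtain u where u: "adapted_frame (tangent_space \<A> p) (\<phi> p) u"
    using assms(3) by (auto simp: definite_3_form_def)
  have iso: "isometric_frame (g p) u" using assms(4) u by (auto simp: associated_metric_def)
  have uP: "u \<in> ori p" and P: "vs_orientation (tangent_space \<A> p) (ori p)"
    using assms(5) u by (auto simp: associated_orientation_def orientation_def)
  have lin: "linear u" using u by (simp add: adapted_frame_def frame_def)
  obtain x y z v where xyz: "\<alpha> p = u x" "\<beta> p = u y" "\<gamma> p = u z" "\<nu> p = u v"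
    using vector_field_frame[OF u] fields \<nu> by metis
  note mult = oct_mult_adapted[of \<A> p \<phi> u g, OF u iso]
  let ?L = "oct_mult \<A> g \<phi> (vec_oct \<alpha>) (a, \<nu>)" and ?R = "oct_mult \<A> g \<phi> (a, \<lambda>p. - \<nu> p) (vec_oct \<beta>)"
  have L: "fst ?L p = - (x \<bullet> v)" "snd ?L p = u (a p *\<^sub>R x + cross0 x v)"
    using mult[of "vec_oct \<alpha>" x "(a, \<nu>)" v] by (simp_all add: vec_oct_def xyz)
  have R: "fst ?R p = v \<bullet> y" "snd ?R p = u (a p *\<^sub>R y - cross0 v y)"
    using mult[of "(a, \<lambda>p. - \<nu> p)" "- v" "vec_oct \<beta>" y]
    by (simp_all add: vec_oct_def xyz linear_neg[OF lin] cross0_linear)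
  have \<phi>: "\<phi> p (u x) (u y) (u z) = phi0 x y z" for x y z using u by (simp add: adapted_frame_def)
  have g: "g p (u x) (u y) = x \<bullet> y" for x y using iso by (simp add: isometric_frame_def)
  \<comment> \<open>The real part of the product pairs with the zero real part of
    \<open>\<gamma>\<close>, and the factor 2 in \<open>oct_form\<close> cancels the 1/2.\<close>
  have "algebraic_twist \<A> g \<phi> A \<alpha> \<beta> \<gamma> p = g p (snd (oct_mult \<A> g \<phi> ?L ?R) p) (\<gamma> p)"
    using assms by (simp add: algebraic_twist_def phi_oct_def oct_form_def vec_oct_def A
      oct_inverse_eq[OF assms(1,3,4)] case_prod_beta)
  also have "\<dots> = (- (x \<bullet> v) *\<^sub>R (a p *\<^sub>R y - cross0 v y) + (v \<bullet> y) *\<^sub>R (a p *\<^sub>R x + cross0 x v)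
      + cross0 (a p *\<^sub>R x + cross0 x v) (a p *\<^sub>R y - cross0 v y)) \<bullet> z"
    by (simp only: mult(2)[OF L(2) R(2)] L(1) R(1) xyz g)
  also have "\<dots> = geometric_twist g ori \<phi> A p (\<alpha> p) (\<beta> p) (\<gamma> p)"
  proof -
    have "wedge_1_2 (g p (u v)) (\<phi> p (u v)) (u x) (u y) (u z) =
        (v \<bullet> x) * phi0 v y z - (v \<bullet> y) * phi0 v x z + (v \<bullet> z) * phi0 v x y"
      using wedge_1_2_skew[of "\<phi> p (u v)" "u y" "u x" "u z" "g p (u v)"]
        phi0_alternating(2)[of v y x] phi0_alternating(2)[of v z x] phi0_alternating(2)[of v z y]
      by (simp only: \<phi> g)
    then show ?thesis
      unfolding twist_R7 geometric_twist_def A xyz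
      by (simp add: \<phi> g xyz hodge_star_adapted[OF P uP iso u])
  qed
  finally show "algebraic_twist \<A> g \<phi> A \<alpha> \<beta> \<gamma> p =
    geometric_twist g ori \<phi> A p (\<alpha> p) (\<beta> p) (\<gamma> p)" .
qed

end
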